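(* Let $P$ be a dcpo which satisfies the property $M$ and in which every element $a\in P$ is the supremum of a directed set of down-linear elements of $P$. Then $P$ is $C_{\sigma}$-unique.
   Context: A dcpo (directed complete poset) is a poset in which every directed (in particular nonempty) subset has a supremum. For a poset $P$ and $A\subseteq P$, $\downarrow A=\{x\in P: x\le y\text{ for some }y\in A\}$ and $\downarrow a=\downarrow\{a\}$. A subset $A$ of a dcpo $P$ is Scott closed if $A=\downarrow A$ and $\bigvee D\in A$ for every directed $D\subseteq A$. $C_{\sigma}(P)$ is the lattice of all Scott closed subsets of $P$ (including $\emptyset$), ordered by inclusion. A dcpo $P$ is $C_{\sigma}$-unique if for every dcpo $Q$, whenever the lattices $C_{\sigma}(P)$ and $C_{\sigma}(Q)$ are isomorphic, $P$ and $Q$ are order-isomorphic. An element $a$ of a poset is down-linear if $\downarrow a$ is a chain (any two elements of $\downarrow a$ are comparable). For a poset $P$ and a finite $A\subseteq P$, $mub(A)$ denotes the set of minimal upper bounds of $A$; it is complete if for every upper bound $x$ of $A$ there is $y\in mub(A)$ with $y\le x$. $P$ satisfies the property $m$ if $mub(A)$ is complete for all finite $A\subseteq P$. $P$ satisfies the property $M$ if it satisfies the property $m$ and $mub(A)$ is finite for all finite $A\subseteq P$. *)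

theory Defs
  imports "HOL-Algebra.Complete_Lattice"
begin

text \<open>
  A poset is a \<^const>\<open>partial_order\<close> structure, so its underlying set is an explicit carrier
  (possibly empty), and \<^term>\<open>is_lub P s D\<close> says that \<^term>\<open>s\<close> is the supremum of \<^term>\<open>D\<close>.
\<close>

definition directed :: "'a gorder \<Rightarrow> 'a set \<Rightarrow> bool" where
  "directed P D \<longleftrightarrow>
     D \<subseteq> carrier P \<and> D \<noteq> {} \<and>
     (\<forall>x\<in>D. \<forall>y\<in>D. \<exists>z\<in>D. x \<sqsubseteq>\<^bsub>P\<^esub> z \<and> y \<sqsubseteq>\<^bsub>P\<^esub> z)"

definition dcpo :: "'a gorder \<Rightarrow> bool" where
  "dcpo P \<longleftrightarrow> partial_order P \<and> (\<forall>D. directed P D \<longrightarrow> (\<exists>s. is_lub P s D))"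

definition down_set :: "'a gorder \<Rightarrow> 'a set \<Rightarrow> 'a set" where
  "down_set P A = {x \<in> carrier P. \<exists>y\<in>A. x \<sqsubseteq>\<^bsub>P\<^esub> y}"

definition scott_closed :: "'a gorder \<Rightarrow> 'a set \<Rightarrow> bool" where
  "scott_closed P A \<longleftrightarrow>
     A \<subseteq> carrier P \<and> A = down_set P A \<and>
     (\<forall>D s. directed P D \<longrightarrow> D \<subseteq> A \<longrightarrow> is_lub P s D \<longrightarrow> s \<in> A)"

definition C_sigma :: "'a gorder \<Rightarrow> 'a set gorder" where
  "C_sigma P = \<lparr>carrier = {A. scott_closed P A}, eq = (=), le = (\<subseteq>)\<rparr>"

lemma C_sigma_partial_order: "partial_order (C_sigma P)"
  by unfold_locales (auto simp: C_sigma_def)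

lemma C_sigma_complete_lattice:
  assumes "partial_order P"
  shows "complete_lattice (C_sigma P)"
proof (rule partial_order.complete_lattice_criterion1[OF C_sigma_partial_order])
  interpret partial_order P by (fact assms)
  have "scott_closed P (carrier P)"
    by (auto simp: scott_closed_def down_set_def least_def Upper_def)
  then have "greatest (C_sigma P) (carrier P) (carrier (C_sigma P))"
    by (auto simp: greatest_def C_sigma_def scott_closed_def)
  then show "\<exists>G. greatest (C_sigma P) G (carrier (C_sigma P))" ..
next
  fix F assume F: "F \<subseteq> carrier (C_sigma P)" "F \<noteq> {}"
  interpret partial_order P by (fact assms)
  have closed: "scott_closed P A" if "A \<in> F" for A
    using that F by (auto simp: C_sigma_def)
  have sub: "\<Inter>F \<subseteq> carrier P"
    using F closed unfolding scott_closed_def by blast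
  have lower: "x \<in> A" if "A \<in> F" "y \<in> A" "x \<in> carrier P" "x \<sqsubseteq>\<^bsub>P\<^esub> y" for A x y
    using closed[OF that(1)] that unfolding scott_closed_def down_set_def by blast
  have down: "\<Inter>F = down_set P (\<Inter>F)"
    using sub le_refl lower unfolding down_set_def by blast
  have sup: "s \<in> \<Inter>F" if "directed P D" "D \<subseteq> \<Inter>F" "is_lub P s D" for D s
    using that closed unfolding scott_closed_def by blast
  have "scott_closed P (\<Inter>F)"
    unfolding scott_closed_def using sub down sup by blast
  then have "greatest (C_sigma P) (\<Inter>F) (Lower (C_sigma P) F)"
    using F by (auto simp: greatest_def Lower_def C_sigma_def)
  then show "\<exists>I. greatest (C_sigma P) I (Lower (C_sigma P) F)" ..
qed

text \<open>
  As lattices are determined by their order, isomorphism of the lattices \<^term>\<open>C_sigma P\<close> and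
  \<^term>\<open>C_sigma Q\<close> is order isomorphism as well.
\<close>

definition order_isomorphic :: "'a gorder \<Rightarrow> 'b gorder \<Rightarrow> bool" where
  "order_isomorphic P Q \<longleftrightarrow>
     (\<exists>f. order_emb P Q f \<and> bij_betw f (carrier P) (carrier Q))"

text \<open>
  The dcpos \<^term>\<open>Q\<close> being compared with \<^term>\<open>P\<close> range over all posets on carriers in a type
  \<open>'b\<close>, which is a parameter because HOL cannot quantify over types in a formula. A theorem
  concluding \<open>C_sigma_unique TYPE('b) P\<close> for a type variable \<open>'b\<close> covers every \<^term>\<open>Q\<close>.
\<close>

definition C_sigma_unique :: "'b itself \<Rightarrow> 'a gorder \<Rightarrow> bool" where
  "C_sigma_unique (_ :: 'b itself) P \<longleftrightarrow>
     (\<forall>Q :: 'b gorder. dcpo Q \<longrightarrow>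
        order_isomorphic (C_sigma P) (C_sigma Q) \<longrightarrow> order_isomorphic P Q)"

definition down_linear :: "'a gorder \<Rightarrow> 'a \<Rightarrow> bool" where
  "down_linear P a \<longleftrightarrow>
     a \<in> carrier P \<and>
     (\<forall>x\<in>down_set P {a}. \<forall>y\<in>down_set P {a}. x \<sqsubseteq>\<^bsub>P\<^esub> y \<or> y \<sqsubseteq>\<^bsub>P\<^esub> x)"

definition mub :: "'a gorder \<Rightarrow> 'a set \<Rightarrow> 'a set" where
  "mub P A = {u \<in> Upper P A. \<forall>v\<in>Upper P A. v \<sqsubseteq>\<^bsub>P\<^esub> u \<longrightarrow> v = u}"

definition mub_complete :: "'a gorder \<Rightarrow> 'a set \<Rightarrow> bool" where
  "mub_complete P A \<longleftrightarrow> (\<forall>x\<in>Upper P A. \<exists>y\<in>mub P A. y \<sqsubseteq>\<^bsub>P\<^esub> x)"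

text \<open>
  The empty set counts as a finite subset below; \<^term>\<open>mub P {}\<close> is the set of minimal elements
  of \<^term>\<open>P\<close>.
\<close>

definition property_m :: "'a gorder \<Rightarrow> bool" where
  "property_m P \<longleftrightarrow> (\<forall>A. A \<subseteq> carrier P \<longrightarrow> finite A \<longrightarrow> mub_complete P A)"

definition property_M :: "'a gorder \<Rightarrow> bool" where
  "property_M P \<longleftrightarrow>
     property_m P \<and> (\<forall>A. A \<subseteq> carrier P \<longrightarrow> finite A \<longrightarrow> finite (mub P A))"

end

theory Submission
  imports Defs
begin

text \<open>
  Let \<open>F\<close> be an isomorphism from the Scott closed sets of \<open>P\<close> to those of another dcpo \<open>Q\<close>.
  The aim is to show that \<open>F\<close> maps the principal ideals \<open>\<down>a\<close> of \<open>P\<close> exactly onto those of \<open>Q\<close>;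
  as a point is determined by its principal ideal, and the order of points is the inclusion of
  their ideals, this makes \<open>P\<close> and \<open>Q\<close> isomorphic.

  \<^bold>\<open>Principal ideals go to principal ideals.\<close> If \<open>d\<close> is down-linear, the Scott closed subsets of
  \<open>\<down>d\<close> form a chain under inclusion, hence so do those of \<open>F (\<down>d)\<close>. In particular
  the elements of \<open>F (\<down>d)\<close> form a chain, and \<open>F (\<down>d)\<close>, which is nonempty and closed under directed
  suprema, is the ideal of its largest element (\<open>down_linear_image_principal\<close>). An arbitrary \<open>a\<close> is
  the supremum of a directed set of such elements \<open>d\<close>, and the largest elements of the sets
  \<open>F (\<down>d)\<close> are directed in \<open>Q\<close>; their supremum generates \<open>F (\<down>a)\<close>
  (\<open>directed_lub_image_principal\<close>).

  \<^bold>\<open>Every principal ideal of \<open>Q\<close> is reached.\<close> Write \<open>F (\<down>b) = \<down>(g b)\<close>, take \<open>x\<close> in \<open>Q\<close>, and let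
  \<open>A\<close> be the Scott closed set with \<open>F A = \<down>x\<close>. Consider the set \<open>K\<close> of all \<open>y\<close> that lie below
  \<open>g b\<close> for some \<open>b \<in> A\<close>. If \<open>K\<close> is Scott closed then, containing \<open>g b\<close> for each \<open>b \<in> A\<close>, it
  contains all of \<open>F A\<close>; so it contains \<open>x\<close>, and \<open>x \<le> g b \<le> x\<close> for some \<open>b \<in> A\<close>.

  Property \<open>M\<close> enters in the proof that \<open>K\<close> is closed under directed suprema. The preimages of
  the ideals \<open>\<down>y\<close>, for \<open>y\<close> in a directed subset of \<open>K\<close>, each have an upper bound in \<open>A\<close>, so every
  finite subset of their union \<open>U\<close> has one, and what is needed is a single upper bound of \<open>U\<close> in
  \<open>A\<close>. This is a compactness property (\<open>upper_bound_compactness\<close>): the sets of upper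
  bounds of finite subsets of \<open>U\<close> are generated by finitely many minimal ones, and a Rudin-style
  argument with Zorn's lemma extracts from them a directed set in \<open>A\<close> whose supremum bounds \<open>U\<close>.
\<close>

section \<open>Scott closed sets and principal ideals\<close>

lemma dcpo_partial_order: "dcpo P \<Longrightarrow> partial_order P"
  by (simp add: dcpo_def)

lemma is_lub_carrier: "is_lub P s D \<Longrightarrow> s \<in> carrier P"
  by (simp add: least_def Upper_def)

lemma is_lub_upper: "is_lub P s D \<Longrightarrow> D \<subseteq> carrier P \<Longrightarrow> d \<in> D \<Longrightarrow> d \<sqsubseteq>\<^bsub>P\<^esub> s"
  by (auto simp: least_def Upper_def)

lemma is_lub_least:
  "is_lub P s D \<Longrightarrow> u \<in> carrier P \<Longrightarrow> (\<And>d. d \<in> D \<Longrightarrow> d \<sqsubseteq>\<^bsub>P\<^esub> u) \<Longrightarrow> s \<sqsubseteq>\<^bsub>P\<^esub> u"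
  by (auto simp: least_def Upper_def)

lemma scott_closed_carrier: "scott_closed P A \<Longrightarrow> A \<subseteq> carrier P"
  by (simp add: scott_closed_def)

lemma scott_closed_lower:
  "scott_closed P A \<Longrightarrow> y \<in> A \<Longrightarrow> x \<in> carrier P \<Longrightarrow> x \<sqsubseteq>\<^bsub>P\<^esub> y \<Longrightarrow> x \<in> A"
  unfolding scott_closed_def down_set_def by blast

lemma scott_closed_lub:
  "scott_closed P A \<Longrightarrow> directed P D \<Longrightarrow> D \<subseteq> A \<Longrightarrow> is_lub P s D \<Longrightarrow> s \<in> A"
  unfolding scott_closed_def by blast

lemma scott_closedI:
  assumes "partial_order P" "A \<subseteq> carrier P"
    and "\<And>x y. y \<in> A \<Longrightarrow> x \<in> carrier P \<Longrightarrow> x \<sqsubseteq>\<^bsub>P\<^esub> y \<Longrightarrow> x \<in> A"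
    and "\<And>D s. directed P D \<Longrightarrow> D \<subseteq> A \<Longrightarrow> is_lub P s D \<Longrightarrow> s \<in> A"
  shows "scott_closed P A"
proof -
  interpret partial_order P by (fact assms)
  have "A = down_set P A"
    using assms(2,3) le_refl unfolding down_set_def by blast
  with assms(2,4) show ?thesis
    unfolding scott_closed_def by blast
qed

lemma in_principal_iff: "x \<in> down_set P {a} \<longleftrightarrow> x \<in> carrier P \<and> x \<sqsubseteq>\<^bsub>P\<^esub> a"
  by (auto simp: down_set_def)

lemma scott_closed_principal:
  assumes "partial_order P" "a \<in> carrier P"
  shows "scott_closed P (down_set P {a})"
proof (rule scott_closedI[OF assms(1)])
  interpret partial_order P by (fact assms)
  show "x \<in> down_set P {a}" if "y \<in> down_set P {a}" "x \<in> carrier P" "x \<sqsubseteq>\<^bsub>P\<^esub> y" for x y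
    using that assms(2) by (auto simp: in_principal_iff intro: le_trans)
  show "s \<in> down_set P {a}"
    if "directed P D" "D \<subseteq> down_set P {a}" "is_lub P s D" for D s
    using that(2) is_lub_least[OF that(3) assms(2)] is_lub_carrier[OF that(3)]
    unfolding in_principal_iff subset_iff by blast
qed (auto simp: in_principal_iff)

lemma principal_subset_iff:
  assumes "partial_order P" "scott_closed P A" "a \<in> carrier P"
  shows "down_set P {a} \<subseteq> A \<longleftrightarrow> a \<in> A"
proof -
  interpret partial_order P by (fact assms)
  show ?thesis
    using assms(3) scott_closed_lower[OF assms(2)] by (auto simp: in_principal_iff subset_iff)
qed

lemma scott_closed_empty: "partial_order P \<Longrightarrow> scott_closed P {}"
  by (rule scott_closedI) (auto simp: directed_def)

lemma directed_finite_bound: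
  assumes "partial_order P" "directed P D" "finite G" "G \<subseteq> D"
  shows "\<exists>z\<in>D. \<forall>x\<in>G. x \<sqsubseteq>\<^bsub>P\<^esub> z"
  using assms(3,4)
proof (induction G rule: finite_induct)
  case empty
  then show ?case using assms(2) by (auto simp: directed_def)
next
  case (insert x G)
  interpret partial_order P by (fact assms)
  obtain z where z: "z \<in> D" "\<forall>x\<in>G. x \<sqsubseteq>\<^bsub>P\<^esub> z"
    using insert by auto
  obtain w where w: "w \<in> D" "x \<sqsubseteq>\<^bsub>P\<^esub> w" "z \<sqsubseteq>\<^bsub>P\<^esub> w"
    using assms(2) z(1) insert.prems unfolding directed_def by blast
  have "D \<subseteq> carrier P" using assms(2) by (simp add: directed_def)
  then have "y \<in> carrier P" "z \<in> carrier P" "w \<in> carrier P" if "y \<in> insert x G" for y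
    using that w z insert.prems by auto
  then have "y \<sqsubseteq>\<^bsub>P\<^esub> w" if "y \<in> insert x G" for y
    using that w z le_trans[of y z w] by auto
  with w(1) show ?case by blast
qed

section \<open>Compactness of sets of upper bounds\<close>

text \<open>
  By property \<open>M\<close> the upper bounds of a finite set \<open>G\<close> are the elements above one of finitely many
  minimal upper bounds. So an upper bound of \<open>G\<close> in the lower set \<open>A\<close> cannot disappear in the
  union of a chain of upper sets: if each member of the chain misses one, so does the union. Zorn's
  lemma gives a largest upper set \<open>W\<close> which, for no finite \<open>G \<subseteq> U\<close>, contains all upper bounds of
  \<open>G\<close> in \<open>A\<close>. Maximality makes \<open>A - W\<close> directed: enlarging \<open>W\<close> by the elements above
  \<open>c \<in> A - W\<close> swallows the upper bounds of some finite \<open>G\<close>, which means that all upper bounds of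
  \<open>G\<close> in \<open>A - W\<close> are above \<open>c\<close>. As \<open>A - W\<close> meets the upper bounds of every single \<open>u \<in> U\<close>,
  its supremum is the required bound.
\<close>

lemma upper_bound_compactness:
  assumes P: "dcpo P" "property_M P" and A: "scott_closed P A" and U: "U \<subseteq> carrier P"
    and bounded: "\<And>G. finite G \<Longrightarrow> G \<subseteq> U \<Longrightarrow> Upper P G \<inter> A \<noteq> {}"
  shows "\<exists>b\<in>A. \<forall>u\<in>U. u \<sqsubseteq>\<^bsub>P\<^esub> b"
proof -
  interpret partial_order P by (rule dcpo_partial_order[OF P(1)])
  define \<W> where "\<W> = {W. W \<subseteq> carrier P \<and> (\<forall>w\<in>W. \<forall>v\<in>carrier P. w \<sqsubseteq>\<^bsub>P\<^esub> v \<longrightarrow> v \<in> W) \<and>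
      (\<forall>G. finite G \<longrightarrow> G \<subseteq> U \<longrightarrow> \<not> Upper P G \<inter> A \<subseteq> W)}"
  have "\<exists>W\<in>\<W>. \<forall>X\<in>\<W>. W \<subseteq> X \<longrightarrow> X = W"
  proof (rule subset_Zorn_nonempty)
    have "{} \<in> \<W>" using bounded by (auto simp: \<W>_def)
    then show "\<W> \<noteq> {}" by blast
  next
    fix \<C> assume ne: "\<C> \<noteq> {}" and chain: "subset.chain \<W> \<C>"
    have sub: "\<C> \<subseteq> \<W>" using chain by (simp add: subset.chain_def)
    have "\<not> Upper P G \<inter> A \<subseteq> \<Union>\<C>" if G: "finite G" "G \<subseteq> U" for G
    proof
      assume covered: "Upper P G \<inter> A \<subseteq> \<Union>\<C>"
      have fin: "finite (mub P G \<inter> A)" and complete: "mub_complete P G"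
        using P(2) G U by (auto simp: property_M_def property_m_def)
      have "mub P G \<inter> A \<subseteq> \<Union>\<C>"
        using covered by (auto simp: mub_def)
      then obtain W where W: "W \<in> \<C>" "mub P G \<inter> A \<subseteq> W"
        using finite_subset_Union_chain[OF fin _ ne chain] by blast
      have "x \<in> W" if "x \<in> Upper P G \<inter> A" for x
      proof -
        obtain m where m: "m \<in> mub P G" "m \<sqsubseteq>\<^bsub>P\<^esub> x"
          using complete \<open>x \<in> Upper P G \<inter> A\<close> by (auto simp: mub_complete_def)
        have "m \<in> carrier P" "x \<in> carrier P"
          using m \<open>x \<in> Upper P G \<inter> A\<close> by (auto simp: mub_def Upper_def)
        moreover from this have "m \<in> A"
          using scott_closed_lower[OF A _ _ m(2)] \<open>x \<in> Upper P G \<inter> A\<close> by blast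
        ultimately show "x \<in> W"
          using m W sub by (auto simp: \<W>_def)
      qed
      then have "Upper P G \<inter> A \<subseteq> W" by blast
      moreover have "W \<in> \<W>" using W(1) sub by blast
      ultimately show False using G by (simp add: \<W>_def)
    qed
    moreover have "\<Union>\<C> \<subseteq> carrier P"
      using sub by (auto simp: \<W>_def)
    moreover have "v \<in> \<Union>\<C>" if v: "w \<in> \<Union>\<C>" "v \<in> carrier P" "w \<sqsubseteq>\<^bsub>P\<^esub> v" for v w
    proof -
      obtain W where W: "W \<in> \<C>" "w \<in> W" using v(1) by blast
      moreover from this have "W \<in> \<W>" using sub by blast
      ultimately have "v \<in> W" using v by (auto simp: \<W>_def)
      with W show ?thesis by blast
    qed
    ultimately show "\<Union>\<C> \<in> \<W>"
      unfolding \<W>_def by (intro CollectI conjI ballI allI impI)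
  qed
  then obtain W where W: "W \<in> \<W>" and maximal: "\<And>X. X \<in> \<W> \<Longrightarrow> W \<subseteq> X \<Longrightarrow> X = W"
    by blast
  have W_upper: "v \<in> W" if "w \<in> W" "v \<in> carrier P" "w \<sqsubseteq>\<^bsub>P\<^esub> v" for v w
    using W that by (auto simp: \<W>_def)
  have meets: "\<exists>c\<in>A - W. c \<in> Upper P G" if "finite G" "G \<subseteq> U" for G
    using W that by (auto simp: \<W>_def)
  have A_carrier: "A \<subseteq> carrier P" by (rule scott_closed_carrier[OF A])
  have swallow: "\<exists>G. finite G \<and> G \<subseteq> U \<and> (\<forall>e\<in>(A - W) \<inter> Upper P G. c \<sqsubseteq>\<^bsub>P\<^esub> e)" if c: "c \<in> A - W" for c
  proof -
    let ?X = "W \<union> {v \<in> carrier P. c \<sqsubseteq>\<^bsub>P\<^esub> v}"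
    have cc: "c \<in> carrier P" using c A_carrier by blast
    then have "c \<in> ?X" by simp
    then have notin: "?X \<notin> \<W>" using maximal[of ?X] c by blast
    have X_carrier: "?X \<subseteq> carrier P" using W by (auto simp: \<W>_def)
    have X_upper: "\<forall>w\<in>?X. \<forall>v\<in>carrier P. w \<sqsubseteq>\<^bsub>P\<^esub> v \<longrightarrow> v \<in> ?X"
      using W_upper cc by (auto intro: le_trans)
    have "\<not> (\<forall>G. finite G \<longrightarrow> G \<subseteq> U \<longrightarrow> \<not> Upper P G \<inter> A \<subseteq> ?X)"
    proof
      assume "\<forall>G. finite G \<longrightarrow> G \<subseteq> U \<longrightarrow> \<not> Upper P G \<inter> A \<subseteq> ?X"
      with X_carrier X_upper have "?X \<in> \<W>"
        unfolding \<W>_def by (intro CollectI conjI)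
      with notin show False ..
    qed
    then obtain G where G: "finite G" "G \<subseteq> U" "Upper P G \<inter> A \<subseteq> ?X"
      by blast
    have "\<forall>e\<in>(A - W) \<inter> Upper P G. c \<sqsubseteq>\<^bsub>P\<^esub> e" using G(3) by auto
    with G(1,2) show ?thesis by (intro exI conjI)
  qed
  have dir: "directed P (A - W)"
    unfolding directed_def
  proof (intro conjI ballI)
    show "A - W \<subseteq> carrier P" using A_carrier by blast
    \<comment> \<open>Every element is an upper bound of the empty set.\<close>
    show "A - W \<noteq> {}" using meets[of "{}"] by auto
    fix c d assume cd: "c \<in> A - W" "d \<in> A - W"
    obtain G where G: "finite G" "G \<subseteq> U" "\<forall>e\<in>(A - W) \<inter> Upper P G. c \<sqsubseteq>\<^bsub>P\<^esub> e"
      using swallow[OF cd(1)] by blast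
    obtain H where H: "finite H" "H \<subseteq> U" "\<forall>e\<in>(A - W) \<inter> Upper P H. d \<sqsubseteq>\<^bsub>P\<^esub> e"
      using swallow[OF cd(2)] by blast
    obtain e where e: "e \<in> A - W" "e \<in> Upper P (G \<union> H)"
      using meets[of "G \<union> H"] G H by auto
    then have "e \<in> Upper P G" "e \<in> Upper P H"
      by (auto simp: Upper_def)
    with e G H show "\<exists>z\<in>A - W. c \<sqsubseteq>\<^bsub>P\<^esub> z \<and> d \<sqsubseteq>\<^bsub>P\<^esub> z" by blast
  qed
  then obtain b where b: "is_lub P b (A - W)"
    using P(1) by (auto simp: dcpo_def)
  have "b \<in> A" using scott_closed_lub[OF A dir _ b] by blast
  moreover have "u \<sqsubseteq>\<^bsub>P\<^esub> b" if u: "u \<in> U" for u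
  proof -
    have uc: "u \<in> carrier P" using u U by blast
    obtain c where c: "c \<in> A - W" "c \<in> Upper P {u}"
      using meets[of "{u}"] u by auto
    then have "u \<sqsubseteq>\<^bsub>P\<^esub> c" using uc by (auto simp: Upper_def)
    moreover have "c \<sqsubseteq>\<^bsub>P\<^esub> b"
      using is_lub_upper[OF b] c A_carrier by blast
    ultimately show ?thesis
      using le_trans[of u c b] uc c(1) A_carrier is_lub_carrier[OF b] by blast
  qed
  ultimately show ?thesis by blast
qed

section \<open>Isomorphisms between lattices of Scott closed sets\<close>

locale closed_set_iso =
  fixes P :: "'a gorder" and Q :: "'b gorder" and F :: "'a set \<Rightarrow> 'b set"
  assumes dcpo_P: "dcpo P" and dcpo_Q: "dcpo Q"
    and closed_image: "\<And>A. scott_closed P A \<Longrightarrow> scott_closed Q (F A)"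
    and image_subset_iff: "\<And>A B. scott_closed P A \<Longrightarrow> scott_closed P B \<Longrightarrow> F A \<subseteq> F B \<longleftrightarrow> A \<subseteq> B"
    and closed_surj: "\<And>B. scott_closed Q B \<Longrightarrow> \<exists>A. scott_closed P A \<and> F A = B"
begin

sublocale P: partial_order P by (rule dcpo_partial_order[OF dcpo_P])
sublocale Q: partial_order Q by (rule dcpo_partial_order[OF dcpo_Q])

lemmas closed_principal_P = scott_closed_principal[OF P.partial_order_axioms]
lemmas closed_principal_Q = scott_closed_principal[OF Q.partial_order_axioms]
lemmas principal_subset_P = principal_subset_iff[OF P.partial_order_axioms]
lemmas principal_subset_Q = principal_subset_iff[OF Q.partial_order_axioms]

text \<open>
  Scott closed subsets of the chain \<open>\<down>d\<close> are lower subsets of a chain, so any two are comparable.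
  Applied to the preimages of \<open>\<down>x\<close> and \<open>\<down>y\<close>, this makes any two elements \<open>x\<close>, \<open>y\<close> of the image
  comparable, and a chain is directed.
\<close>

lemma down_linear_image_principal:
  assumes "down_linear P d"
  shows "\<exists>x\<in>carrier Q. F (down_set P {d}) = down_set Q {x}"
proof -
  let ?B = "F (down_set P {d})"
  have dc: "d \<in> carrier P" using assms by (simp add: down_linear_def)
  note cd = closed_principal_P[OF dc]
  have cB: "scott_closed Q ?B" by (rule closed_image[OF cd])
  have Bc: "?B \<subseteq> carrier Q" by (rule scott_closed_carrier[OF cB])
  have chain: "x \<sqsubseteq>\<^bsub>Q\<^esub> y \<or> y \<sqsubseteq>\<^bsub>Q\<^esub> x" if x: "x \<in> ?B" and y: "y \<in> ?B" for x y
  proof -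
    have xy: "x \<in> carrier Q" "y \<in> carrier Q" using x y Bc by auto
    obtain X where X: "scott_closed P X" "F X = down_set Q {x}"
      using closed_surj[OF closed_principal_Q[OF xy(1)]] by blast
    obtain Y where Y: "scott_closed P Y" "F Y = down_set Q {y}"
      using closed_surj[OF closed_principal_Q[OF xy(2)]] by blast
    have sub: "X \<subseteq> down_set P {d}" "Y \<subseteq> down_set P {d}"
      using image_subset_iff[OF X(1) cd] image_subset_iff[OF Y(1) cd]
        principal_subset_Q[OF cB] X(2) Y(2) x y xy by auto
    have "X \<subseteq> Y \<or> Y \<subseteq> X"
    proof (rule ccontr)
      assume "\<not> (X \<subseteq> Y \<or> Y \<subseteq> X)"
      then obtain p q where pq: "p \<in> X" "p \<notin> Y" "q \<in> Y" "q \<notin> X" by blast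
      then have "p \<sqsubseteq>\<^bsub>P\<^esub> q \<or> q \<sqsubseteq>\<^bsub>P\<^esub> p"
        using assms sub unfolding down_linear_def by blast
      moreover have "p \<in> carrier P" "q \<in> carrier P"
        using pq scott_closed_carrier X(1) Y(1) by blast+
      ultimately show False
        using pq scott_closed_lower[OF X(1)] scott_closed_lower[OF Y(1)] by blast
    qed
    then have "down_set Q {x} \<subseteq> down_set Q {y} \<or> down_set Q {y} \<subseteq> down_set Q {x}"
      using image_subset_iff[OF X(1) Y(1)] image_subset_iff[OF Y(1) X(1)] X(2) Y(2) by auto
    then show ?thesis
      using xy by (auto simp: principal_subset_Q closed_principal_Q in_principal_iff)
  qed
  have "?B \<noteq> {}"
  proof
    assume "?B = {}"
    then have "down_set P {d} \<subseteq> {}"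
      using image_subset_iff[OF cd scott_closed_empty[OF P.partial_order_axioms]] by blast
    moreover have "d \<in> down_set P {d}" using dc by (simp add: in_principal_iff)
    ultimately show False by blast
  qed
  then have dir: "directed Q ?B"
    using Bc chain unfolding directed_def by (metis Q.le_refl subsetD)
  then obtain s where s: "is_lub Q s ?B"
    using dcpo_Q by (auto simp: dcpo_def)
  have sB: "s \<in> ?B" using scott_closed_lub[OF cB dir _ s] by blast
  have sc: "s \<in> carrier Q" by (rule is_lub_carrier[OF s])
  have "?B \<subseteq> down_set Q {s}"
    using is_lub_upper[OF s Bc] Bc by (auto simp: in_principal_iff)
  moreover have "down_set Q {s} \<subseteq> ?B"
    using principal_subset_Q[OF cB sc] sB by blast
  ultimately show ?thesis using sc by blast
qed

text \<open>
  Let \<open>s\<close> be the supremum of the generators \<open>g d\<close> of the sets \<open>F (\<down>d)\<close>. The Scott closed set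
  \<open>F (\<down>a)\<close> contains every \<open>g d\<close>, hence \<open>s\<close>; the preimage of \<open>\<down>s\<close> is Scott closed and contains
  every \<open>d\<close>, hence \<open>a\<close>. The two inclusions give \<open>F (\<down>a) = \<down>s\<close>.
\<close>

lemma directed_lub_image_principal:
  assumes D: "directed P D" and a: "is_lub P a D"
    and principal: "\<And>d. d \<in> D \<Longrightarrow> \<exists>x\<in>carrier Q. F (down_set P {d}) = down_set Q {x}"
  shows "\<exists>x\<in>carrier Q. F (down_set P {a}) = down_set Q {x}"
proof -
  have Dc: "D \<subseteq> carrier P" using D by (simp add: directed_def)
  have ac: "a \<in> carrier P" by (rule is_lub_carrier[OF a])
  note ca = closed_principal_P[OF ac]
  obtain g where g: "\<And>d. d \<in> D \<Longrightarrow> g d \<in> carrier Q \<and> F (down_set P {d}) = down_set Q {g d}"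
    using principal by metis
  have mono: "g d \<sqsubseteq>\<^bsub>Q\<^esub> g e" if "d \<in> D" "e \<in> D" "d \<sqsubseteq>\<^bsub>P\<^esub> e" for d e
  proof -
    have dce: "d \<in> carrier P" "e \<in> carrier P" using that Dc by auto
    then have "down_set P {d} \<subseteq> down_set P {e}"
      using that by (auto simp: principal_subset_P closed_principal_P in_principal_iff)
    then have "down_set Q {g d} \<subseteq> down_set Q {g e}"
      using image_subset_iff[OF closed_principal_P closed_principal_P] dce g that by metis
    then show ?thesis
      using g that by (auto simp: principal_subset_Q closed_principal_Q in_principal_iff)
  qed
  have dir: "directed Q (g ` D)"
    unfolding directed_def
  proof (intro conjI ballI)
    show "g ` D \<subseteq> carrier Q" using g by blast
    show "g ` D \<noteq> {}" using D by (simp add: directed_def)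
    fix x y assume "x \<in> g ` D" "y \<in> g ` D"
    then obtain d e where de: "d \<in> D" "x = g d" "e \<in> D" "y = g e" by blast
    then obtain f where "f \<in> D" "d \<sqsubseteq>\<^bsub>P\<^esub> f" "e \<sqsubseteq>\<^bsub>P\<^esub> f"
      using D unfolding directed_def by blast
    with de mono show "\<exists>z\<in>g ` D. x \<sqsubseteq>\<^bsub>Q\<^esub> z \<and> y \<sqsubseteq>\<^bsub>Q\<^esub> z" by blast
  qed
  then obtain s where s: "is_lub Q s (g ` D)"
    using dcpo_Q by (auto simp: dcpo_def)
  have sc: "s \<in> carrier Q" by (rule is_lub_carrier[OF s])
  obtain S where S: "scott_closed P S" "F S = down_set Q {s}"
    using closed_surj[OF closed_principal_Q[OF sc]] by blast
  have "g d \<in> F (down_set P {a})" if "d \<in> D" for d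
  proof -
    have "d \<in> carrier P" using that Dc by blast
    moreover from this have "down_set P {d} \<subseteq> down_set P {a}"
      using is_lub_upper[OF a Dc that] ac
      by (auto simp: principal_subset_P closed_principal_P in_principal_iff)
    ultimately have "down_set Q {g d} \<subseteq> F (down_set P {a})"
      using image_subset_iff[OF closed_principal_P ca] g[OF that] by metis
    then show ?thesis using g[OF that] principal_subset_Q[OF closed_image[OF ca]] by blast
  qed
  then have "s \<in> F (down_set P {a})"
    using scott_closed_lub[OF closed_image[OF ca] dir _ s] by blast
  then have "down_set Q {s} \<subseteq> F (down_set P {a})"
    using principal_subset_Q[OF closed_image[OF ca] sc] by blast
  moreover have "d \<in> S" if "d \<in> D" for d
  proof -
    have dc: "d \<in> carrier P" using that Dc by blast
    have "g d \<sqsubseteq>\<^bsub>Q\<^esub> s" using is_lub_upper[OF s] dir that by (auto simp: directed_def)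
    then have "down_set Q {g d} \<subseteq> down_set Q {s}"
      using g[OF that] sc by (auto simp: principal_subset_Q closed_principal_Q in_principal_iff)
    then have "down_set P {d} \<subseteq> S"
      using image_subset_iff[OF closed_principal_P[OF dc] S(1)] g[OF that] S(2) by auto
    then show ?thesis using principal_subset_P[OF S(1) dc] by blast
  qed
  then have "a \<in> S" using scott_closed_lub[OF S(1) D _ a] by blast
  then have "F (down_set P {a}) \<subseteq> down_set Q {s}"
    using principal_subset_P[OF S(1) ac] image_subset_iff[OF ca S(1)] S(2) by blast
  ultimately show ?thesis using sc by blast
qed

text \<open>
  The key step is that the elements of \<open>Q\<close> lying below some \<open>g b\<close> with \<open>b \<in> A\<close> form a Scott
  closed set. For \<open>y\<close> in a directed subset of it, the preimage of \<open>\<down>y\<close> lies in \<open>\<down>b\<close>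
  for some \<open>b \<in> A\<close> depending on \<open>y\<close>; compactness yields one \<open>b\<close> that serves all \<open>y\<close> at once.
\<close>

lemma principal_is_image:
  assumes M: "property_M P"
    and g: "\<And>a. a \<in> carrier P \<Longrightarrow> g a \<in> carrier Q \<and> F (down_set P {a}) = down_set Q {g a}"
    and x: "x \<in> carrier Q"
  shows "\<exists>b\<in>carrier P. x = g b"
proof -
  obtain A where A: "scott_closed P A" "F A = down_set Q {x}"
    using closed_surj[OF closed_principal_Q[OF x]] by blast
  have Ac: "A \<subseteq> carrier P" by (rule scott_closed_carrier[OF A(1)])
  obtain H where H: "\<And>B. scott_closed Q B \<Longrightarrow> scott_closed P (H B) \<and> F (H B) = B"
    using closed_surj by metis
  have H_below: "H (down_set Q {y}) \<subseteq> down_set P {b} \<longleftrightarrow> y \<sqsubseteq>\<^bsub>Q\<^esub> g b"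
    if y: "y \<in> carrier Q" and b: "b \<in> carrier P" for y b
  proof -
    have "H (down_set Q {y}) \<subseteq> down_set P {b} \<longleftrightarrow> down_set Q {y} \<subseteq> down_set Q {g b}"
      using image_subset_iff[OF _ closed_principal_P[OF b]] H[OF closed_principal_Q[OF y]] g[OF b]
      by metis
    also have "\<dots> \<longleftrightarrow> y \<sqsubseteq>\<^bsub>Q\<^esub> g b"
      using y g[OF b] by (auto simp: principal_subset_Q closed_principal_Q in_principal_iff)
    finally show ?thesis .
  qed
  define K where "K = {y \<in> carrier Q. \<exists>b\<in>A. y \<sqsubseteq>\<^bsub>Q\<^esub> g b}"
  have K: "scott_closed Q K"
  proof (rule scott_closedI[OF Q.partial_order_axioms])
    show "K \<subseteq> carrier Q" by (auto simp: K_def)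
    show "z \<in> K" if z: "y \<in> K" "z \<in> carrier Q" "z \<sqsubseteq>\<^bsub>Q\<^esub> y" for y z
    proof -
      obtain b where "b \<in> A" "y \<sqsubseteq>\<^bsub>Q\<^esub> g b" "y \<in> carrier Q"
        using z(1) by (auto simp: K_def)
      moreover from this have "g b \<in> carrier Q" using g Ac by blast
      ultimately show ?thesis using z Q.le_trans[of z y "g b"] by (auto simp: K_def)
    qed
  next
    fix D s assume D: "directed Q D" "D \<subseteq> K" "is_lub Q s D"
    have Dc: "D \<subseteq> carrier Q" using D(1) by (simp add: directed_def)
    define U where "U = (\<Union>y\<in>D. H (down_set Q {y}))"
    have Uc: "U \<subseteq> carrier P"
      using H closed_principal_Q scott_closed_carrier Dc unfolding U_def by blast
    have "Upper P G \<inter> A \<noteq> {}" if G: "finite G" "G \<subseteq> U" for G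
    proof -
      have "\<forall>p\<in>G. \<exists>y\<in>D. p \<in> H (down_set Q {y})" using G(2) by (auto simp: U_def)
      then obtain c where c: "\<And>p. p \<in> G \<Longrightarrow> c p \<in> D \<and> p \<in> H (down_set Q {c p})" by metis
      obtain y where y: "y \<in> D" "\<forall>z\<in>c ` G. z \<sqsubseteq>\<^bsub>Q\<^esub> y"
        using directed_finite_bound[OF Q.partial_order_axioms D(1), of "c ` G"] G(1) c by blast
      then obtain b where b: "b \<in> A" "y \<sqsubseteq>\<^bsub>Q\<^esub> g b" using D(2) by (auto simp: K_def)
      have bc: "b \<in> carrier P" using b Ac by blast
      have "p \<sqsubseteq>\<^bsub>P\<^esub> b" if p: "p \<in> G" for p
      proof -
        have cpc: "c p \<in> carrier Q" using c[OF p] Dc by blast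
        moreover have "c p \<sqsubseteq>\<^bsub>Q\<^esub> g b"
          using Q.le_trans[of "c p" y "g b"] cpc y p b g[OF bc] Dc by blast
        ultimately have "H (down_set Q {c p}) \<subseteq> down_set P {b}"
          using H_below bc by blast
        with c[OF p] show ?thesis by (auto simp: in_principal_iff)
      qed
      then have "b \<in> Upper P G" using bc by (auto simp: Upper_def)
      with b show ?thesis by blast
    qed
    then obtain b where b: "b \<in> A" "\<forall>u\<in>U. u \<sqsubseteq>\<^bsub>P\<^esub> b"
      using upper_bound_compactness[OF dcpo_P M A(1) Uc] by blast
    have bc: "b \<in> carrier P" using b Ac by blast
    have "y \<sqsubseteq>\<^bsub>Q\<^esub> g b" if "y \<in> D" for y
    proof -
      have "H (down_set Q {y}) \<subseteq> down_set P {b}"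
        using b(2) Uc that by (auto simp: U_def in_principal_iff)
      then show ?thesis using H_below bc that Dc by blast
    qed
    then have "s \<sqsubseteq>\<^bsub>Q\<^esub> g b" using is_lub_least[OF D(3)] g[OF bc] by blast
    then show "s \<in> K" using b(1) is_lub_carrier[OF D(3)] by (auto simp: K_def)
  qed
  have gK: "g b \<in> K" if "b \<in> A" for b
    using that g[of b] Ac Q.le_refl[of "g b"] unfolding K_def by blast
  have "A \<subseteq> H K"
  proof
    fix b assume b: "b \<in> A"
    then have bc: "b \<in> carrier P" using Ac by blast
    have "F (down_set P {b}) \<subseteq> F (H K)"
      using principal_subset_Q[OF K] gK[OF b] g[OF bc] H[OF K] by auto
    then have "down_set P {b} \<subseteq> H K"
      using image_subset_iff[OF closed_principal_P[OF bc]] H[OF K] by blast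
    then show "b \<in> H K"
      using principal_subset_P H[OF K] bc by blast
  qed
  then have "down_set Q {x} \<subseteq> K"
    using image_subset_iff[OF A(1)] H[OF K] A(2) by metis
  then have "x \<in> K" using principal_subset_Q[OF K x] by blast
  then obtain b where b: "b \<in> A" "x \<sqsubseteq>\<^bsub>Q\<^esub> g b" by (auto simp: K_def)
  have bc: "b \<in> carrier P" using b Ac by blast
  have "down_set P {b} \<subseteq> A" using principal_subset_P[OF A(1) bc] b by blast
  then have "down_set Q {g b} \<subseteq> down_set Q {x}"
    using image_subset_iff[OF closed_principal_P[OF bc] A(1)] g[OF bc] A(2) by auto
  then have "g b \<sqsubseteq>\<^bsub>Q\<^esub> x"
    using g[OF bc] x by (auto simp: principal_subset_Q closed_principal_Q in_principal_iff)
  then have "x = g b" using b(2) x g[OF bc] by blast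
  with bc show ?thesis by blast
qed

lemma isomorphic_if_images_principal:
  assumes M: "property_M P"
    and principal: "\<And>a. a \<in> carrier P \<Longrightarrow> \<exists>x\<in>carrier Q. F (down_set P {a}) = down_set Q {x}"
  shows "order_isomorphic P Q"
proof -
  obtain g where g: "\<And>a. a \<in> carrier P \<Longrightarrow> g a \<in> carrier Q \<and> F (down_set P {a}) = down_set Q {g a}"
    using principal by metis
  have emb: "g a \<sqsubseteq>\<^bsub>Q\<^esub> g b \<longleftrightarrow> a \<sqsubseteq>\<^bsub>P\<^esub> b" if "a \<in> carrier P" "b \<in> carrier P" for a b
  proof -
    have "g a \<sqsubseteq>\<^bsub>Q\<^esub> g b \<longleftrightarrow> down_set Q {g a} \<subseteq> down_set Q {g b}"
      using g that by (auto simp: principal_subset_Q closed_principal_Q in_principal_iff)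
    also have "\<dots> \<longleftrightarrow> down_set P {a} \<subseteq> down_set P {b}"
      using image_subset_iff[OF closed_principal_P closed_principal_P] g that by metis
    also have "\<dots> \<longleftrightarrow> a \<sqsubseteq>\<^bsub>P\<^esub> b"
      using that by (auto simp: principal_subset_P closed_principal_P in_principal_iff)
    finally show ?thesis .
  qed
  have "inj_on g (carrier P)"
  proof (rule inj_onI)
    fix a b assume ab: "a \<in> carrier P" "b \<in> carrier P" "g a = g b"
    then have "g a \<sqsubseteq>\<^bsub>Q\<^esub> g b" "g b \<sqsubseteq>\<^bsub>Q\<^esub> g a" using g by auto
    with ab emb show "a = b" by blast
  qed
  moreover have "g ` carrier P = carrier Q"
    using principal_is_image[OF M g] g by blast
  ultimately have "bij_betw g (carrier P) (carrier Q)"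
    by (simp add: bij_betw_def)
  moreover have "order_emb P Q g"
    unfolding order_emb_def
    using emb P.weak_partial_order_axioms Q.weak_partial_order_axioms by blast
  ultimately show ?thesis unfolding order_isomorphic_def by blast
qed

end

lemma closed_set_isoI:
  assumes "dcpo P" "dcpo Q" "order_emb (C_sigma P) (C_sigma Q) F"
    and bij: "bij_betw F (carrier (C_sigma P)) (carrier (C_sigma Q))"
  shows "closed_set_iso P Q F"
proof
  show "scott_closed Q (F A)" if "scott_closed P A" for A
    using bij_betwE[OF bij] that by (auto simp: C_sigma_def)
  show "F A \<subseteq> F B \<longleftrightarrow> A \<subseteq> B" if "scott_closed P A" "scott_closed P B" for A B
    using assms(3) that by (auto simp: order_emb_def C_sigma_def)
  show "\<exists>A. scott_closed P A \<and> F A = B" if "scott_closed Q B" for B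
  proof -
    have "B \<in> F ` carrier (C_sigma P)"
      using bij_betw_imp_surj_on[OF bij] that by (simp add: C_sigma_def)
    then show ?thesis by (auto simp: C_sigma_def)
  qed
qed (fact assms)+

section \<open>Uniqueness\<close>

theorem theorem3p16:
  fixes P :: "'a gorder"
  assumes "dcpo P"
    and "property_M P"
    and "\<forall>a\<in>carrier P. \<exists>D. directed P D \<and> (\<forall>d\<in>D. down_linear P d) \<and> is_lub P a D"
  shows "C_sigma_unique TYPE('b) P"
  unfolding C_sigma_unique_def
proof (intro allI impI)
  fix Q :: "'b gorder"
  assume Q: "dcpo Q" and "order_isomorphic (C_sigma P) (C_sigma Q)"
  then obtain F where "order_emb (C_sigma P) (C_sigma Q) F"
    "bij_betw F (carrier (C_sigma P)) (carrier (C_sigma Q))"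
    unfolding order_isomorphic_def by blast
  then interpret closed_set_iso P Q F
    by (rule closed_set_isoI[OF assms(1) Q])
  show "order_isomorphic P Q"
  proof (rule isomorphic_if_images_principal[OF assms(2)])
    fix a assume "a \<in> carrier P"
    then obtain D where D: "directed P D" "\<forall>d\<in>D. down_linear P d" "is_lub P a D"
      using assms(3) by blast
    show "\<exists>x\<in>carrier Q. F (down_set P {a}) = down_set Q {x}"
      by (rule directed_lub_image_principal[OF D(1,3)])
        (use D(2) down_linear_image_principal in blast)
  qed
qed

end
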